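(* Let $n\ge 3$ and let $*:(\mathcal{Z}^n_s)^2\to\mathcal{Z}^n_s$ be an operation on the class $\mathcal{Z}^n_s$ of $o$-symmetric zonoids in $\mathbb{R}^n$. Then $*$ is continuous in the Hausdorff metric and $GL(n)$ covariant if and only if there are constants $a,b\ge 0$ such that $K*L=aK+bL$ for all $K,L\in\mathcal{Z}^n_s$, where $+$ denotes Minkowski addition.
   Context: A zonotope is a finite Minkowski sum of line segments in $\mathbb{R}^n$; a zonoid is a limit in the Hausdorff metric of zonotopes. $\mathcal{Z}^n_s$ is the class of $o$-symmetric ($K=-K$) zonoids in $\mathbb{R}^n$; these need not have nonempty interior. Minkowski addition is $X+Y=\{x+y:x\in X,\ y\in Y\}$, and $tX=\{tx:x\in X\}$. Continuity in the Hausdorff metric means: if $K_m\to M$ and $L_m\to N$ in the Hausdorff metric as $m\to\infty$, with all sets in $\mathcal{Z}^n_s$, then $K_m*L_m\to M*N$. The operation $*$ is $GL(n)$ covariant if $\phi(K*L)=\phi K*\phi L$ for all $\phi\in GL(n)$ and all $K,L\in\mathcal{Z}^n_s$. *)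

theory Defs
  imports "HOL-Analysis.Analysis"
begin

(* Addition of sets, and hence also the finite sum of sets, is Minkowski addition
   (HOL-Library.Set_Algebras); the empty sum is {0}, the degenerate segment at 0. *)
definition zonotope :: "'a::real_vector set \<Rightarrow> bool" where
  "zonotope Z \<longleftrightarrow>
     (\<exists>(k::nat) a b. Z = (\<Sum>i<k. closed_segment (a i) (b i)))"

(* The suprema are meaningful for nonempty bounded sets; below, the distance is only
   used between nonempty compact sets. *)
definition hausdorff_dist :: "'a::metric_space set \<Rightarrow> 'a set \<Rightarrow> real" where
  "hausdorff_dist A B = max (SUP x\<in>A. infdist x B) (SUP y\<in>B. infdist y A)"

definition hausdorff_tendsto :: "(nat \<Rightarrow> 'a::metric_space set) \<Rightarrow> 'a set \<Rightarrow> bool" where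
  "hausdorff_tendsto K M \<longleftrightarrow> (\<lambda>m. hausdorff_dist (K m) M) \<longlonglongrightarrow> 0"

(* Limits are taken in the space of nonempty compact sets. Convexity of a limit of
   zonotopes is automatic and need not be demanded. *)
definition zonoid :: "'a::euclidean_space set \<Rightarrow> bool" where
  "zonoid Z \<longleftrightarrow> compact Z \<and> Z \<noteq> {} \<and>
     (\<exists>P. (\<forall>m. zonotope (P m)) \<and> hausdorff_tendsto P Z)"

definition sym_zonoids :: "'a::euclidean_space set set" where
  "sym_zonoids = {K. zonoid K \<and> K = uminus ` K}"

(* An operation on the class of symmetric zonoids is a total function on sets of which
   only the values on that class matter. *)
definition hausdorff_continuous_op ::
    "('a::euclidean_space set \<Rightarrow> 'a set \<Rightarrow> 'a set) \<Rightarrow> bool" where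
  "hausdorff_continuous_op star \<longleftrightarrow>
     (\<forall>K L M N. (\<forall>m. K m \<in> sym_zonoids) \<and> (\<forall>m. L m \<in> sym_zonoids) \<and>
        M \<in> sym_zonoids \<and> N \<in> sym_zonoids \<and>
        hausdorff_tendsto K M \<and> hausdorff_tendsto L N \<longrightarrow>
        hausdorff_tendsto (\<lambda>m. star (K m) (L m)) (star M N))"

definition GL_covariant_op ::
    "((real^'n) set \<Rightarrow> (real^'n) set \<Rightarrow> (real^'n) set) \<Rightarrow> bool" where
  "GL_covariant_op star \<longleftrightarrow>
     (\<forall>A::real^'n^'n. invertible A \<longrightarrow>
        (\<forall>K\<in>sym_zonoids. \<forall>L\<in>sym_zonoids.
           (*v) A ` star K L = star ((*v) A ` K) ((*v) A ` L)))"

end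

theory Submission
  imports Defs
begin

text \<open>By continuity the covariance extends from \<open>GL(n)\<close> to maps \<open>x \<mapsto> (u \<bullet> x) e\<close> of rank one, which
  send a symmetric convex body \<open>K\<close> to the segment \<open>[-h\<^sub>K(u) e, h\<^sub>K(u) e]\<close>. Hence there is one function
  \<open>f\<close> of two variables such that the support function of \<open>K * L\<close> is \<open>f(h\<^sub>K, h\<^sub>L)\<close>. For
  \<open>K = [-e\<^sub>1, e\<^sub>1] + [-e\<^sub>2, e\<^sub>2]\<close> and \<open>L = [-e\<^sub>3, e\<^sub>3]\<close> the function \<open>f(\<bar>u\<^sub>1\<bar> + \<bar>u\<^sub>2\<bar>, \<bar>u\<^sub>3\<bar>)\<close> is
  therefore the support function of a zonoid, i.e. a limit of sums of absolute values of linear forms.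
  An inequality for three real numbers carries over to it and yields
  \<open>f(2s, t) + f(0, t) \<le> 2 f(s, t)\<close>. Iterating this and comparing with the
  sublinearity of support functions forces \<open>f(s, t) = s f(1, 0) + t f(0, 1)\<close>.\<close>

section \<open>Hausdorff distance\<close>

lemma hausdorff_dist_commute: "hausdorff_dist A B = hausdorff_dist B A"
  by (simp add: hausdorff_dist_def max.commute)

lemma hausdorff_dist_le:
  assumes "A \<noteq> {}" "B \<noteq> {}"
    and "\<And>x. x \<in> A \<Longrightarrow> \<exists>y\<in>B. dist x y \<le> e"
    and "\<And>y. y \<in> B \<Longrightarrow> \<exists>x\<in>A. dist y x \<le> e"
  shows "hausdorff_dist A B \<le> e"
proof -
  have "infdist x B \<le> e" if "x \<in> A" for x
    using assms(3)[OF that] infdist_le2 by blast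
  moreover have "infdist y A \<le> e" if "y \<in> B" for y
    using assms(4)[OF that] infdist_le2 by blast
  ultimately show ?thesis
    unfolding hausdorff_dist_def using assms(1,2) by (auto intro!: cSUP_least)
qed

text \<open>A real supremum is an upper bound only for a bounded family; compactness of
  \<open>A\<close> bounds the distances to \<open>B\<close>.\<close>

lemma infdist_le_hausdorff_dist:
  assumes "compact A" "x \<in> A"
  shows "infdist x B \<le> hausdorff_dist A B"
proof -
  have "compact ((\<lambda>x. infdist x B) ` A)"
    by (intro compact_continuous_image continuous_intros assms)
  then have "infdist x B \<le> (SUP x\<in>A. infdist x B)"
    by (intro cSUP_upper assms bounded_imp_bdd_above compact_imp_bounded)
  then show ?thesis by (simp add: hausdorff_dist_def)
qed

lemma hausdorff_dist_attained:
  fixes A B :: "'a::heine_borel set"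
  assumes "compact A" "compact B" "B \<noteq> {}" "x \<in> A"
  shows "\<exists>y\<in>B. dist x y \<le> hausdorff_dist A B"
  using infdist_attains_inf[of B x] infdist_le_hausdorff_dist[OF assms(1,4), of B]
    assms(2,3) compact_imp_closed by metis

lemma hausdorff_dist_nonneg:
  assumes "compact A" "A \<noteq> {}"
  shows "0 \<le> hausdorff_dist A B"
  using assms infdist_le_hausdorff_dist[OF assms(1)] infdist_nonneg order_trans by blast

text \<open>Turns every later convergence claim into an upper estimate by a null sequence;
  compactness and nonemptiness of \<open>K m\<close> supply the lower bound 0.\<close>

lemma hausdorff_tendsto_squeeze:
  assumes "\<And>m. compact (K m) \<and> K m \<noteq> {}"
    and "\<And>m. hausdorff_dist (K m) M \<le> c m" "c \<longlonglongrightarrow> 0"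
  shows "hausdorff_tendsto K M"
  unfolding hausdorff_tendsto_def
  by (rule tendsto_sandwich[OF _ _ tendsto_const assms(3)])
    (auto simp: assms hausdorff_dist_nonneg)

lemma hausdorff_tendsto_mult_zero:
  assumes "hausdorff_tendsto K M"
  shows "(\<lambda>m. c * hausdorff_dist (K m) M) \<longlonglongrightarrow> 0"
  using assms unfolding hausdorff_tendsto_def by (rule tendsto_mult_right_zero)

lemma hausdorff_tendsto_const:
  assumes "compact K" "K \<noteq> {}"
  shows "hausdorff_tendsto (\<lambda>_. K) K"
proof (rule hausdorff_tendsto_squeeze)
  show "hausdorff_dist K K \<le> 0"
    using assms(2) by (intro hausdorff_dist_le) auto
qed (use assms in auto)

text \<open>Two points of \<open>Z\<close> are replaced by nearby points of \<open>P m\<close>,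
  combined there, and the combination is moved back to \<open>Z\<close>. Each of the two passages
  costs at most \<open>hausdorff_dist (P m) Z\<close>, so the combination has distance 0 from the
  closed set \<open>Z\<close>.\<close>

lemma convex_hausdorff_limit:
  fixes P :: "nat \<Rightarrow> 'a::euclidean_space set"
  assumes P: "\<And>m. compact (P m) \<and> convex (P m) \<and> P m \<noteq> {}"
    and Z: "compact Z" "Z \<noteq> {}" "hausdorff_tendsto P Z"
  shows "convex Z"
proof (rule convexI)
  fix x y :: 'a and u v :: real
  assume xy: "x \<in> Z" "y \<in> Z" and uv: "0 \<le> u" "0 \<le> v" "u + v = 1"
  define z where "z = u *\<^sub>R x + v *\<^sub>R y"
  have bound: "infdist z Z \<le> 2 * hausdorff_dist (P m) Z" for m
  proof -
    let ?d = "hausdorff_dist (P m) Z"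
    obtain p q where p: "p \<in> P m" "dist x p \<le> ?d" and q: "q \<in> P m" "dist y q \<le> ?d"
      using hausdorff_dist_attained[OF Z(1), of "P m"] P xy
      by (metis hausdorff_dist_commute)
    define r where "r = u *\<^sub>R p + v *\<^sub>R q"
    have "r \<in> P m"
      unfolding r_def using P p q uv convexD by blast
    then obtain w where w: "w \<in> Z" "dist r w \<le> ?d"
      using hausdorff_dist_attained P Z(1,2) by blast
    have "dist z r = norm (u *\<^sub>R (x - p) + v *\<^sub>R (y - q))"
      by (simp add: z_def r_def dist_norm algebra_simps)
    also have "\<dots> \<le> u * dist x p + v * dist y q"
      using norm_triangle_ineq[of "u *\<^sub>R (x - p)" "v *\<^sub>R (y - q)"] uv by (simp add: dist_norm)
    also have "\<dots> \<le> u * ?d + v * ?d"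
      using p q uv by (intro add_mono mult_left_mono) auto
    also have "\<dots> = ?d"
      using uv by (simp flip: distrib_right)
    finally have "dist z w \<le> 2 * ?d"
      using w dist_triangle[of z w r] by linarith
    then show ?thesis
      using w infdist_le2 by blast
  qed
  have "(\<lambda>m. 2 * hausdorff_dist (P m) Z) \<longlonglongrightarrow> 0"
    using Z(3) by (rule hausdorff_tendsto_mult_zero)
  then have "infdist z Z \<le> 0"
    using LIMSEQ_le_const bound by blast
  then show "u *\<^sub>R x + v *\<^sub>R y \<in> Z"
    using Z in_closed_iff_infdist_zero[of Z z] infdist_nonneg[of z Z] compact_imp_closed
    by (auto simp: z_def)
qed

lemma hausdorff_dist_linear_image:
  fixes f :: "'a::euclidean_space \<Rightarrow> 'b::euclidean_space"
  assumes "linear f" and A: "compact A" "A \<noteq> {}" and B: "compact B" "B \<noteq> {}"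
  shows "hausdorff_dist (f ` A) (f ` B) \<le> onorm f * hausdorff_dist A B"
proof -
  have bl: "bounded_linear f" using assms(1) by (simp add: linear_conv_bounded_linear)
  have est: "dist (f x) (f y) \<le> onorm f * r" if "dist x y \<le> r" for x y r
  proof -
    have "dist (f x) (f y) \<le> onorm f * dist x y"
      using onorm[OF bl, of "x - y"] by (simp add: dist_norm linear_diff[OF assms(1)])
    also have "\<dots> \<le> onorm f * r"
      using that onorm_pos_le[OF bl] by (rule mult_left_mono)
    finally show ?thesis .
  qed
  show ?thesis
  proof (rule hausdorff_dist_le)
    show "\<exists>y\<in>f ` B. dist x y \<le> onorm f * hausdorff_dist A B" if "x \<in> f ` A" for x
      using that hausdorff_dist_attained[OF A(1) B] est by fastforce
    show "\<exists>y\<in>f ` A. dist x y \<le> onorm f * hausdorff_dist A B" if "x \<in> f ` B" for x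
      using that hausdorff_dist_attained[OF B(1) A] est
      unfolding hausdorff_dist_commute[of A B] by fastforce
  qed (use A B in auto)
qed

section \<open>Minkowski sums\<close>

lemma compact_set_plus:
  fixes A B :: "'a::real_normed_vector set"
  assumes "compact A" "compact B"
  shows "compact (A + B)"
  using compact_sums[OF assms] by (simp add: set_plus_def Bex_def conj_ac)

lemma set_plus_nonempty: "A \<noteq> {} \<Longrightarrow> B \<noteq> {} \<Longrightarrow> A + B \<noteq> ({} :: 'a::plus set)"
  by (auto simp: set_plus_def)

lemma linear_image_set_plus:
  assumes "linear f"
  shows "f ` (A + B) = f ` A + f ` B"
  by (force simp: set_plus_def linear_add[OF assms])

lemma hausdorff_dist_set_plus:
  fixes A B C D :: "'a::euclidean_space set"
  assumes "compact A" "A \<noteq> {}" "compact B" "B \<noteq> {}" "compact C" "C \<noteq> {}" "compact D" "D \<noteq> {}"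
  shows "hausdorff_dist (A + B) (C + D) \<le> hausdorff_dist A C + hausdorff_dist B D"
proof (rule hausdorff_dist_le)
  have aux: "\<exists>y\<in>Y + Y'. dist x y \<le> hausdorff_dist X Y + hausdorff_dist X' Y'"
    if "x \<in> X + X'" and X: "compact X" "compact Y" "Y \<noteq> {}"
      and X': "compact X'" "compact Y'" "Y' \<noteq> {}"
    for x and X Y X' Y' :: "'a set"
  proof -
    obtain p q where pq: "p \<in> X" "q \<in> X'" "x = p + q"
      using \<open>x \<in> X + X'\<close> by (auto elim: set_plus_elim)
    obtain r s where r: "r \<in> Y" "dist p r \<le> hausdorff_dist X Y"
        and s: "s \<in> Y'" "dist q s \<le> hausdorff_dist X' Y'"
      using hausdorff_dist_attained[OF X pq(1)] hausdorff_dist_attained[OF X' pq(2)] by blast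
    then have "dist x (r + s) \<le> hausdorff_dist X Y + hausdorff_dist X' Y'"
      using dist_triangle_add[of p q r s] pq(3) by simp
    then show ?thesis
      using set_plus_intro[OF r(1) s(1)] by blast
  qed
  show "\<exists>y\<in>C + D. dist x y \<le> hausdorff_dist A C + hausdorff_dist B D" if "x \<in> A + B" for x
    using aux that assms by blast
  show "\<exists>y\<in>A + B. dist x y \<le> hausdorff_dist A C + hausdorff_dist B D" if "x \<in> C + D" for x
    using aux[OF that] assms unfolding hausdorff_dist_commute[of A C] hausdorff_dist_commute[of B D]
    by blast
qed (use assms set_plus_nonempty in auto)

section \<open>Support functions\<close>

definition support_fun :: "'a::real_inner set \<Rightarrow> 'a \<Rightarrow> real" where
  "support_fun K u = (SUP x\<in>K. u \<bullet> x)"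

lemma inner_le_support_fun:
  assumes "compact K" "x \<in> K"
  shows "u \<bullet> x \<le> support_fun K u"
proof -
  have "compact ((\<lambda>x. u \<bullet> x) ` K)"
    by (intro compact_continuous_image continuous_intros assms)
  then show ?thesis
    unfolding support_fun_def
    by (intro cSUP_upper assms bounded_imp_bdd_above compact_imp_bounded)
qed

lemma support_fun_least:
  assumes "K \<noteq> {}" "\<And>x. x \<in> K \<Longrightarrow> u \<bullet> x \<le> c"
  shows "support_fun K u \<le> c"
  unfolding support_fun_def using assms by (rule cSUP_least)

lemma support_fun_attained:
  assumes "compact K" "K \<noteq> {}"
  obtains x where "x \<in> K" "support_fun K u = u \<bullet> x"
proof -
  have "continuous_on K (\<lambda>x. u \<bullet> x)" by (intro continuous_intros)
  then obtain x where "x \<in> K" "\<And>y. y \<in> K \<Longrightarrow> u \<bullet> y \<le> u \<bullet> x"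
    using continuous_attains_sup[OF assms] by blast
  then show ?thesis
    using that support_fun_least[OF assms(2)] inner_le_support_fun[OF assms(1)]
    by (metis order_antisym)
qed

lemma support_fun_add_le:
  assumes "compact K" "K \<noteq> {}"
  shows "support_fun K (u + v) \<le> support_fun K u + support_fun K v"
  using assms by (intro support_fun_least)
    (auto simp: inner_add_left intro!: add_mono inner_le_support_fun)

lemma support_fun_scaleR:
  assumes "compact K" "K \<noteq> {}" "0 \<le> c"
  shows "support_fun K (c *\<^sub>R u) = c * support_fun K u"
proof (rule antisym)
  show "support_fun K (c *\<^sub>R u) \<le> c * support_fun K u"
    using assms by (intro support_fun_least) (auto intro: mult_left_mono inner_le_support_fun)
  obtain x where x: "x \<in> K" "support_fun K u = u \<bullet> x"
    using support_fun_attained assms by blast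
  then show "c * support_fun K u \<le> support_fun K (c *\<^sub>R u)"
    using inner_le_support_fun[OF assms(1) x(1), of "c *\<^sub>R u"] by simp
qed

lemma support_fun_set_plus:
  assumes "compact K" "K \<noteq> {}" "compact L" "L \<noteq> {}"
  shows "support_fun (K + L) u = support_fun K u + support_fun L u"
proof (rule antisym)
  show "support_fun (K + L) u \<le> support_fun K u + support_fun L u"
    using assms set_plus_nonempty
    by (intro support_fun_least)
      (auto elim!: set_plus_elim simp: inner_add_right intro!: add_mono inner_le_support_fun)
  obtain x y where "x \<in> K" "support_fun K u = u \<bullet> x" "y \<in> L" "support_fun L u = u \<bullet> y"
    using support_fun_attained assms by metis
  then show "support_fun K u + support_fun L u \<le> support_fun (K + L) u"
    using inner_le_support_fun[OF compact_set_plus[OF assms(1,3)], of "x + y" u]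
    by (auto simp: inner_add_right set_plus_intro)
qed

lemma support_fun_image_scaleR:
  assumes "compact K" "K \<noteq> {}" "0 \<le> c"
  shows "support_fun ((\<lambda>x. c *\<^sub>R x) ` K) u = c * support_fun K u"
proof -
  have "support_fun ((\<lambda>x. c *\<^sub>R x) ` K) u = support_fun K (c *\<^sub>R u)"
    by (simp add: support_fun_def image_image)
  then show ?thesis using support_fun_scaleR[OF assms] by simp
qed

lemma support_fun_closed_segment:
  "support_fun (closed_segment a b) u = max (u \<bullet> a) (u \<bullet> b)"
proof (rule antisym)
  have "linear (\<lambda>x. u \<bullet> x)"
    using bounded_linear_inner_right bounded_linear.linear by blast
  then have "(\<lambda>x. u \<bullet> x) ` closed_segment a b = closed_segment (u \<bullet> a) (u \<bullet> b)"
    by (metis closed_segment_linear_image)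
  then have "u \<bullet> x \<le> max (u \<bullet> a) (u \<bullet> b)" if "x \<in> closed_segment a b" for x
    using that by (auto simp: closed_segment_eq_real_ivl split: if_splits dest!: imageI[of x _ "(\<bullet>) u"])
  then show "support_fun (closed_segment a b) u \<le> max (u \<bullet> a) (u \<bullet> b)"
    by (intro support_fun_least) auto
  show "max (u \<bullet> a) (u \<bullet> b) \<le> support_fun (closed_segment a b) u"
    by (simp add: inner_le_support_fun)
qed

text \<open>A maximiser of \<open>u\<close> on one body has a point of the other within the
  Hausdorff distance, and Cauchy-Schwarz bounds the change of the inner product. Hausdorff limits
  thus become pointwise limits of support functions.\<close>

lemma abs_support_fun_diff_le:
  fixes K L :: "'a::euclidean_space set"
  assumes "compact K" "K \<noteq> {}" "compact L" "L \<noteq> {}"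
  shows "\<bar>support_fun K u - support_fun L u\<bar> \<le> norm u * hausdorff_dist K L"
proof -
  have aux: "support_fun X u \<le> support_fun Y u + norm u * hausdorff_dist X Y"
    if XY: "compact X" "X \<noteq> {}" "compact Y" "Y \<noteq> {}" for X Y :: "'a set"
  proof -
    obtain x where x: "x \<in> X" "support_fun X u = u \<bullet> x"
      using support_fun_attained XY by blast
    then obtain y where y: "y \<in> Y" "dist x y \<le> hausdorff_dist X Y"
      using hausdorff_dist_attained XY by blast
    have "u \<bullet> x = u \<bullet> y + u \<bullet> (x - y)" by (simp add: inner_diff_right)
    also have "\<dots> \<le> support_fun Y u + norm u * dist x y"
      using y XY norm_cauchy_schwarz[of u "x - y"]
      by (intro add_mono inner_le_support_fun) (auto simp: dist_norm)
    also have "\<dots> \<le> support_fun Y u + norm u * hausdorff_dist X Y"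
      using y by (simp add: mult_left_mono)
    finally show ?thesis using x by simp
  qed
  show ?thesis
    using aux[OF assms] aux[OF assms(3,4,1,2)] by (simp add: hausdorff_dist_commute abs_le_iff)
qed

lemma tendsto_support_fun:
  fixes K :: "nat \<Rightarrow> 'a::euclidean_space set"
  assumes "hausdorff_tendsto K M" "\<And>m. compact (K m) \<and> K m \<noteq> {}" "compact M" "M \<noteq> {}"
  shows "(\<lambda>m. support_fun (K m) u) \<longlonglongrightarrow> support_fun M u"
proof (rule LIM_zero_cancel, rule Lim_null_comparison)
  show "\<forall>\<^sub>F m in sequentially. norm (support_fun (K m) u - support_fun M u) \<le> norm u * hausdorff_dist (K m) M"
    using abs_support_fun_diff_le[of "K _" M] assms(2-4) by (intro always_eventually allI) simp
  show "(\<lambda>m. norm u * hausdorff_dist (K m) M) \<longlonglongrightarrow> 0"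
    using assms(1) by (rule hausdorff_tendsto_mult_zero)
qed

text \<open>A point of \<open>K\<close> outside the closed convex set \<open>L\<close> is strictly
  separated from \<open>L\<close>. The separation puts \<open>L\<close> on the larger side of
  \<open>a\<close>, so the support functions are compared at \<open>- a\<close>.\<close>

lemma support_fun_le_imp_subset:
  fixes K L :: "'a::euclidean_space set"
  assumes "compact K" "compact L" "convex L" "L \<noteq> {}"
    and "\<And>u. support_fun K u \<le> support_fun L u"
  shows "K \<subseteq> L"
proof
  fix x assume x: "x \<in> K"
  show "x \<in> L"
  proof (rule ccontr)
    assume "x \<notin> L"
    then obtain a b where ab: "a \<bullet> x < b" "\<And>y. y \<in> L \<Longrightarrow> b < a \<bullet> y"
      using separating_hyperplane_closed_point[of L x] assms compact_imp_closed by blast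
    obtain y where "y \<in> L" "support_fun L (- a) = - a \<bullet> y"
      using support_fun_attained assms by blast
    then show False
      using ab inner_le_support_fun[OF assms(1) x, of "- a"] assms(5)[of "- a"] by fastforce
  qed
qed

lemma support_fun_inject:
  fixes K L :: "'a::euclidean_space set"
  assumes "compact K" "convex K" "K \<noteq> {}" "compact L" "convex L" "L \<noteq> {}"
    and "\<And>u. support_fun K u = support_fun L u"
  shows "K = L"
  using assms support_fun_le_imp_subset by (metis order_antisym order_refl)

section \<open>Zonotopes and zonoids\<close>

lemma zonotope_compact_convex:
  fixes Z :: "'a::euclidean_space set"
  assumes "zonotope Z"
  shows "compact Z" "convex Z" "Z \<noteq> {}"
proof -
  have "compact (\<Sum>i<k. closed_segment (a i) (b i)) \<and> convex (\<Sum>i<k. closed_segment (a i) (b i))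
      \<and> (\<Sum>i<k. closed_segment (a i) (b i)) \<noteq> {}" for k :: nat and a b :: "nat \<Rightarrow> 'a"
  proof (induction k)
    case (Suc k)
    then show ?case
      by (simp add: compact_set_plus convex_set_plus set_plus_nonempty)
  qed (simp add: set_zero)
  then show "compact Z" "convex Z" "Z \<noteq> {}"
    using assms by (auto simp: zonotope_def)
qed

lemma zonotope_linear_image:
  fixes f :: "'a::real_vector \<Rightarrow> 'b::real_vector"
  assumes "linear f" "zonotope Z"
  shows "zonotope (f ` Z)"
proof -
  obtain k a b where Z: "Z = (\<Sum>i<(k::nat). closed_segment (a i) (b i))"
    using assms(2) by (auto simp: zonotope_def)
  have "f ` (\<Sum>i<k. closed_segment (a i) (b i)) = (\<Sum>i<k. f ` closed_segment (a i) (b i))"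
    for k :: nat
  proof (induction k)
    case 0
    then show ?case using linear_0[OF assms(1)] by (simp add: set_zero)
  next
    case (Suc k)
    then show ?case by (simp add: linear_image_set_plus[OF assms(1)])
  qed
  then have "f ` Z = (\<Sum>i<k. closed_segment (f (a i)) (f (b i)))"
    by (simp add: Z closed_segment_linear_image[OF assms(1)])
  then show ?thesis unfolding zonotope_def
    by (intro exI[of _ k] exI[of _ "\<lambda>i. f (a i)"] exI[of _ "\<lambda>i. f (b i)"])
qed

lemma zonotope_closed_segment: "zonotope (closed_segment a b)"
  unfolding zonotope_def by (rule exI[of _ 1], rule exI[of _ "\<lambda>_. a"], rule exI[of _ "\<lambda>_. b"]) simp

lemma zonotope_closed_segment_plus: "zonotope (closed_segment a b + closed_segment c d)"
  unfolding zonotope_def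
  by (rule exI[of _ 2], rule exI[of _ "\<lambda>i. if i = 0 then a else c"],
      rule exI[of _ "\<lambda>i. if i = 0 then b else d"]) (simp add: numeral_2_eq_2)

lemma zonotope_imp_zonoid:
  assumes "zonotope Z" shows "zonoid Z"
  using zonotope_compact_convex[OF assms] assms hausdorff_tendsto_const[of Z]
  unfolding zonoid_def by (intro conjI exI[of _ "\<lambda>_. Z"]) auto

text \<open>A linear map sends zonotopes to zonotopes and is Lipschitz, so the images of the
  approximating zonotopes approximate the image of the limit.\<close>

lemma zonoid_linear_image:
  assumes "linear f" "zonoid Z" shows "zonoid (f ` Z)"
proof -
  obtain P where Z: "compact Z" "Z \<noteq> {}" and P: "\<And>m. zonotope (P m)" "hausdorff_tendsto P Z"
    using assms(2) by (auto simp: zonoid_def)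
  have cont: "continuous_on S f" for S
    using assms(1) by (simp add: linear_continuous_on linear_conv_bounded_linear)
  have "hausdorff_tendsto (\<lambda>m. f ` P m) (f ` Z)"
  proof (rule hausdorff_tendsto_squeeze)
    show "hausdorff_dist (f ` P m) (f ` Z) \<le> onorm f * hausdorff_dist (P m) Z" for m
      by (intro hausdorff_dist_linear_image assms Z zonotope_compact_convex P)
    show "(\<lambda>m. onorm f * hausdorff_dist (P m) Z) \<longlonglongrightarrow> 0"
      using P(2) by (rule hausdorff_tendsto_mult_zero)
    show "compact (f ` P m) \<and> f ` P m \<noteq> {}" for m
      using compact_continuous_image[OF cont] zonotope_compact_convex(1,3)[OF P(1)[of m]] by simp
  qed
  then show ?thesis
    using compact_continuous_image[OF cont Z(1)] Z(2) zonotope_linear_image[OF assms(1) P(1)]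
    unfolding zonoid_def by (intro conjI exI[of _ "\<lambda>m. f ` P m"]) simp_all
qed

section \<open>Symmetric zonoids and their support functions\<close>

lemma sym_zonoidsD:
  fixes K :: "'a::euclidean_space set"
  assumes "K \<in> sym_zonoids"
  shows "compact K" "K \<noteq> {}" "convex K" "x \<in> K \<Longrightarrow> - x \<in> K"
proof -
  show K: "compact K" "K \<noteq> {}"
    using assms by (auto simp: sym_zonoids_def zonoid_def)
  obtain P where "\<And>m. zonotope (P m)" "hausdorff_tendsto P K"
    using assms by (auto simp: sym_zonoids_def zonoid_def)
  then show "convex K"
    using convex_hausdorff_limit K zonotope_compact_convex by metis
  show "- x \<in> K" if "x \<in> K"
    using assms that by (auto simp: sym_zonoids_def)
qed

lemma sym_zonoidsI:
  assumes "zonoid K" "\<And>x. x \<in> K \<Longrightarrow> - x \<in> K"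
  shows "K \<in> sym_zonoids"
proof -
  have "x \<in> uminus ` K" if "x \<in> K" for x
    using assms(2)[OF that] by (metis add.inverse_inverse imageI)
  then show ?thesis
    using assms by (auto simp: sym_zonoids_def)
qed

lemma sym_zonoids_linear_image:
  assumes "linear f" "K \<in> sym_zonoids" shows "f ` K \<in> sym_zonoids"
proof (rule sym_zonoidsI)
  show "zonoid (f ` K)"
    using assms zonoid_linear_image by (auto simp: sym_zonoids_def)
  show "- x \<in> f ` K" if "x \<in> f ` K" for x
    using that sym_zonoidsD(4)[OF assms(2)] linear_neg[OF assms(1)] by (metis imageE imageI)
qed

lemma uminus_closed_segment: "x \<in> closed_segment (- a) a \<Longrightarrow> - x \<in> closed_segment (- a) a"
  for a :: "'a::real_vector"
  using closed_segment_linear_image[of uminus "- a" a] linear_uminus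
  by (metis add.inverse_inverse closed_segment_commute imageI)

lemma sym_zonoids_closed_segment: "closed_segment (- a) a \<in> sym_zonoids"
  by (intro sym_zonoidsI zonotope_imp_zonoid zonotope_closed_segment uminus_closed_segment)

lemma sym_zonoids_closed_segment_plus:
  "closed_segment (- a) a + closed_segment (- b) b \<in> sym_zonoids"
proof (intro sym_zonoidsI zonotope_imp_zonoid zonotope_closed_segment_plus)
  fix x assume "x \<in> closed_segment (- a) a + closed_segment (- b) b"
  then obtain p q where "p \<in> closed_segment (- a) a" "q \<in> closed_segment (- b) b" "- x = - p + - q"
    by (auto elim: set_plus_elim)
  then show "- x \<in> closed_segment (- a) a + closed_segment (- b) b"
    using uminus_closed_segment set_plus_intro by metis
qed

lemma support_fun_uminus:
  assumes "K \<in> sym_zonoids"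
  shows "support_fun K (- u) = support_fun K u"
proof -
  have "K = uminus ` K" using assms by (simp add: sym_zonoids_def)
  then have "support_fun K (- u) = support_fun (uminus ` K) (- u)" by simp
  also have "\<dots> = support_fun K u"
    by (simp add: support_fun_def image_image)
  finally show ?thesis .
qed

lemma support_fun_nonneg:
  assumes "K \<in> sym_zonoids"
  shows "0 \<le> support_fun K u"
proof -
  obtain x where x: "x \<in> K" using sym_zonoidsD(2)[OF assms] by blast
  have "u \<bullet> x \<le> support_fun K u" "u \<bullet> (- x) \<le> support_fun K u"
    using x sym_zonoidsD[OF assms] by (auto intro!: inner_le_support_fun simp del: inner_minus_right)
  then show ?thesis by simp
qed

text \<open>The zonotopes approximating a symmetric zonoid need not be symmetric themselves. Adding
  the value at \<open>- u\<close> symmetrizes: for each segment, max p q + max (-p) (-q) = \<bar>p -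
  q\<bar>, which leaves a sum of absolute values of linear forms.\<close>

lemma zonotope_width:
  fixes Z :: "'a::euclidean_space set"
  assumes "zonotope Z"
  obtains k :: nat and c where "\<And>u. support_fun Z u + support_fun Z (- u) = (\<Sum>i<k. \<bar>u \<bullet> c i\<bar>)"
proof -
  obtain k a b where Z: "Z = (\<Sum>i<(k::nat). closed_segment (a i) (b i))"
    using assms by (auto simp: zonotope_def)
  have supp: "support_fun (\<Sum>i<k. closed_segment (a i) (b i)) u = (\<Sum>i<k. max (u \<bullet> a i) (u \<bullet> b i))"
    for k :: nat and u
  proof (induction k)
    case 0
    then show ?case by (simp add: support_fun_def set_zero)
  next
    case (Suc k)
    have "zonotope (\<Sum>i<k. closed_segment (a i) (b i))"
      by (auto simp: zonotope_def)
    with Suc show ?case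
      by (simp add: support_fun_set_plus zonotope_compact_convex support_fun_closed_segment)
  qed
  have "support_fun Z u + support_fun Z (- u) = (\<Sum>i<k. \<bar>u \<bullet> (a i - b i)\<bar>)" for u
    unfolding Z supp sum.distrib[symmetric] by (intro sum.cong) (auto simp: inner_diff_right)
  then show ?thesis by (rule that)
qed

text \<open>The left-hand side carries the three-term sum, so this bounds from above what Hlawka's
  inequality bounds from below; the price is the term \<open>2\<bar>x\<bar> + 2\<bar>y\<bar> - \<bar>x + y\<bar> - \<bar>x - y\<bar>\<close>, that is
  \<open>2 min \<bar>x\<bar> \<bar>y\<bar>\<close>, whose analogue vanishes in the application.\<close>

lemma abs_four_point_inequality:
  fixes x y z :: real
  shows "\<bar>x + y + z\<bar> + \<bar>z\<bar> + \<bar>x + y\<bar> + \<bar>x - y\<bar> \<le> \<bar>x + z\<bar> + \<bar>y + z\<bar> + 2 * \<bar>x\<bar> + 2 * \<bar>y\<bar>"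
proof -
  have "\<bar>x + y\<bar> + \<bar>x - y\<bar> = 2 * max \<bar>x\<bar> \<bar>y\<bar>" by linarith
  moreover have "\<bar>x + y + z\<bar> \<le> \<bar>x + z\<bar> + \<bar>y\<bar>" "\<bar>x + y + z\<bar> \<le> \<bar>y + z\<bar> + \<bar>x\<bar>"
    "\<bar>z\<bar> \<le> \<bar>x + z\<bar> + \<bar>x\<bar>" "\<bar>z\<bar> \<le> \<bar>y + z\<bar> + \<bar>y\<bar>" by linarith+
  ultimately show ?thesis by (simp add: max_def split: if_splits)
qed

text \<open>The inequality is linear in the support function, so it passes from a single \<bar>u
  \<bullet> c\<bar> to the finite sums giving zonotope widths, and from there to limits. By symmetry
  the limiting width is twice the support function of \<open>K\<close>.\<close>

lemma zonoid_four_point_inequality: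
  fixes K :: "'a::euclidean_space set"
  assumes K: "K \<in> sym_zonoids"
  shows "support_fun K (u + v + w) + support_fun K w + support_fun K (u + v) + support_fun K (u - v)
    \<le> support_fun K (u + w) + support_fun K (v + w) + 2 * support_fun K u + 2 * support_fun K v"
proof -
  define ineq where "ineq h \<longleftrightarrow>
    h (u + v + w) + h w + h (u + v) + h (u - v) \<le> h (u + w) + h (v + w) + 2 * h u + 2 * h v"
    for h :: "'a \<Rightarrow> real"
  obtain P where P: "\<And>m. zonotope (P m)" "hausdorff_tendsto P K"
    using K by (auto simp: sym_zonoids_def zonoid_def)
  define h where "h m u = support_fun (P m) u + support_fun (P m) (- u)" for m u
  have "ineq (h m)" for m
  proof -
    obtain k :: nat and c where c: "\<And>u. h m u = (\<Sum>i<k. \<bar>u \<bullet> c i\<bar>)"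
      using zonotope_width[OF P(1)[of m]] unfolding h_def by metis
    show ?thesis
      unfolding ineq_def c sum_distrib_left sum.distrib[symmetric]
      by (rule sum_mono) (simp add: inner_add_left inner_diff_left abs_four_point_inequality)
  qed
  moreover have "(\<lambda>m. h m u) \<longlonglongrightarrow> 2 * support_fun K u" for u
  proof -
    have "(\<lambda>m. h m u) \<longlonglongrightarrow> support_fun K u + support_fun K (- u)"
      unfolding h_def using zonotope_compact_convex[OF P(1)] P(2) sym_zonoidsD[OF K]
      by (intro tendsto_add tendsto_support_fun) auto
    then show ?thesis by (simp add: support_fun_uminus[OF K])
  qed
  moreover from this have
    "(\<lambda>m. h m (u + v + w) + h m w + h m (u + v) + h m (u - v)) \<longlonglongrightarrow>
      2 * support_fun K (u + v + w) + 2 * support_fun K w + 2 * support_fun K (u + v) + 2 * support_fun K (u - v)"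
    "(\<lambda>m. h m (u + w) + h m (v + w) + 2 * h m u + 2 * h m v) \<longlonglongrightarrow>
      2 * support_fun K (u + w) + 2 * support_fun K (v + w) + 2 * (2 * support_fun K u) + 2 * (2 * support_fun K v)"
    by (intro tendsto_add tendsto_mult_left; assumption)+
  ultimately have "ineq (\<lambda>u. 2 * support_fun K u)"
    unfolding ineq_def by (blast intro: LIMSEQ_le)
  then show ?thesis by (simp add: ineq_def)
qed

section \<open>Reduction to rank one\<close>

text \<open>If \<open>x\<close> maximises \<open>u\<close> on \<open>K\<close>, the segment from
  \<open>- x\<close> to \<open>x\<close> lies in \<open>K\<close> by symmetry and convexity and
  already maps onto the whole segment; symmetry also keeps the image of every other point
  inside.\<close>

lemma rank_one_image_sym_zonoid:
  fixes e :: "'a::euclidean_space"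
  assumes "K \<in> sym_zonoids"
  shows "(\<lambda>x. (u \<bullet> x) *\<^sub>R e) ` K = closed_segment (- (support_fun K u *\<^sub>R e)) (support_fun K u *\<^sub>R e)"
proof -
  note K = sym_zonoidsD[OF assms]
  let ?\<phi> = "\<lambda>x. (u \<bullet> x) *\<^sub>R e" and ?h = "support_fun K u"
  have lin: "linear ?\<phi>"
    by (intro linearI) (auto simp: inner_add_right algebra_simps)
  have lin': "linear (\<lambda>c::real. c *\<^sub>R e)"
    by (intro linearI) (auto simp: algebra_simps)
  obtain x where x: "x \<in> K" "?h = u \<bullet> x"
    using support_fun_attained K by blast
  have "closed_segment (- x) x \<subseteq> K"
    using x K closed_segment_subset by blast
  then have "?\<phi> ` closed_segment (- x) x \<subseteq> ?\<phi> ` K" by blast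
  then have "closed_segment (- (?h *\<^sub>R e)) (?h *\<^sub>R e) \<subseteq> ?\<phi> ` K"
    using x(2) by (simp add: closed_segment_linear_image[OF lin, symmetric])
  moreover have "?\<phi> y \<in> closed_segment (- (?h *\<^sub>R e)) (?h *\<^sub>R e)" if "y \<in> K" for y
  proof -
    have "u \<bullet> y \<le> ?h" "u \<bullet> (- y) \<le> ?h"
      using that K by (auto intro!: inner_le_support_fun simp del: inner_minus_right)
    then have "u \<bullet> y \<in> closed_segment (- ?h) ?h"
      by (auto simp: closed_segment_eq_real_ivl)
    then show ?thesis
      using closed_segment_linear_image[OF lin', of "- ?h" ?h] by auto
  qed
  ultimately show ?thesis by blast
qed

text \<open>Serves to approximate a singular linear map by invertible ones; the error
  \<open>c m *\<^sub>R x\<close> is uniformly small because \<open>K\<close> is bounded.\<close>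

lemma hausdorff_tendsto_perturb:
  fixes f :: "'a::euclidean_space \<Rightarrow> 'a"
  assumes "compact K" "K \<noteq> {}" "linear f" "c \<longlonglongrightarrow> 0"
  shows "hausdorff_tendsto (\<lambda>m. (\<lambda>x. f x + c m *\<^sub>R x) ` K) (f ` K)"
proof -
  obtain B where B: "\<And>x. x \<in> K \<Longrightarrow> norm x \<le> B"
    using compact_imp_bounded[OF assms(1)] by (auto simp: bounded_iff)
  show ?thesis
  proof (rule hausdorff_tendsto_squeeze)
    fix m
    have "continuous_on K f"
      using assms(3) by (simp add: linear_continuous_on linear_conv_bounded_linear)
    then show "compact ((\<lambda>x. f x + c m *\<^sub>R x) ` K) \<and> (\<lambda>x. f x + c m *\<^sub>R x) ` K \<noteq> {}"
      using assms by (auto intro!: compact_continuous_image continuous_intros)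
    have "dist (f x + c m *\<^sub>R x) (f x) \<le> \<bar>c m\<bar> * B" if "x \<in> K" for x
      using B[OF that] by (simp add: dist_norm mult_left_mono)
    moreover from this have "dist (f x) (f x + c m *\<^sub>R x) \<le> \<bar>c m\<bar> * B" if "x \<in> K" for x
      using that by (metis dist_commute)
    ultimately show "hausdorff_dist ((\<lambda>x. f x + c m *\<^sub>R x) ` K) (f ` K) \<le> \<bar>c m\<bar> * B"
      using assms(2) by (intro hausdorff_dist_le) blast+
  next
    show "(\<lambda>m. \<bar>c m\<bar> * B) \<longlonglongrightarrow> 0"
      using assms(4) by (intro tendsto_mult_left_zero tendsto_rabs_zero)
  qed
qed

text \<open>The map \<open>\<phi>\<close>, x \<mapsto> (u \<bullet> x) e, is of rank at most one, so
  covariance is applied to the invertible perturbations \<open>A m\<close> and continuity gives the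
  limit. The right-hand side sees \<open>K\<close>, \<open>L\<close> and \<open>u\<close> only
  through the two numbers \<open>support_fun K u\<close> and \<open>support_fun L u\<close>, while
  the unit vector \<open>e\<close> may be fixed once for all.\<close>

lemma support_fun_star:
  fixes star :: "(real^'n) set \<Rightarrow> (real^'n) set \<Rightarrow> (real^'n) set" and e :: "real^'n"
  assumes closed: "\<And>K L. K \<in> sym_zonoids \<Longrightarrow> L \<in> sym_zonoids \<Longrightarrow> star K L \<in> sym_zonoids"
    and cont: "hausdorff_continuous_op star" and cov: "GL_covariant_op star"
    and KL: "K \<in> sym_zonoids" "L \<in> sym_zonoids" and e: "norm e = 1"
  shows "support_fun (star K L) u =
    support_fun (star (closed_segment (- (support_fun K u *\<^sub>R e)) (support_fun K u *\<^sub>R e))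
                      (closed_segment (- (support_fun L u *\<^sub>R e)) (support_fun L u *\<^sub>R e))) e"
proof -
  define \<phi> where "\<phi> x = (u \<bullet> x) *\<^sub>R e" for x
  \<comment> \<open>The sign keeps the perturbation off the only possibly nonzero eigenvalue of \<open>\<phi>\<close>.\<close>
  define c where "c m = (if u \<bullet> e \<ge> 0 then 1 else - 1) / real (Suc m)" for m
  define A where "A m x = \<phi> x + c m *\<^sub>R x" for m x
  have c: "c \<longlonglongrightarrow> 0"
    unfolding c_def using LIMSEQ_Suc[OF lim_const_over_n] by blast
  have lin: "linear \<phi>"
    unfolding \<phi>_def by (intro linearI) (auto simp: inner_add_right algebra_simps)
  have linA: "linear (A m)" for m
    unfolding A_def using lin
    by (intro linear_compose_add) (auto intro: linear_scaleR linear_compose_scale_right linear_id)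
  have inv: "invertible (matrix (A m))" for m
  proof -
    have "x = 0" if "A m x = 0" for x
    proof -
      \<comment> \<open>The second factor is nonzero by the choice of sign, so
        \<open>A m x = 0\<close> forces u \<bullet> x = 0; then only \<open>c m *\<^sub>R x\<close>
        remains, and \<open>c m\<close> is nonzero.\<close>
      have "u \<bullet> A m x = (u \<bullet> x) * ((u \<bullet> e) + c m)"
        by (simp add: A_def \<phi>_def inner_add_right algebra_simps)
      moreover have "c m > 0" if "u \<bullet> e \<ge> 0"
        using that by (simp add: c_def)
      moreover have "c m < 0" if "\<not> u \<bullet> e \<ge> 0"
        using that by (simp add: c_def)
      ultimately have "u \<bullet> x = 0 \<or> u \<bullet> A m x \<noteq> 0" "c m \<noteq> 0"
        by (cases "u \<bullet> e \<ge> 0"; force)+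
      then show "x = 0"
        using that by (auto simp: A_def \<phi>_def)
    qed
    then have "inj (A m)"
      using linear_injective_0[OF linA] by blast
    then show ?thesis
      using linA matrix_left_invertible_injective[of "matrix (A m)"]
      by (simp add: invertible_left_inverse matrix_vector_mul inj_def)
  qed
  have star_A: "A m ` star K L = star (A m ` K) (A m ` L)" for m
    using cov inv[of m] KL matrix_vector_mul(2)[OF linA[of m]]
    unfolding GL_covariant_op_def by metis
  have tends: "hausdorff_tendsto (\<lambda>m. A m ` X) (\<phi> ` X)" if "X \<in> sym_zonoids" for X
    unfolding A_def using hausdorff_tendsto_perturb[OF _ _ lin c] sym_zonoidsD[OF that] by blast
  note imgs = sym_zonoids_linear_image[OF lin] sym_zonoids_linear_image[OF linA]
  have "hausdorff_tendsto (\<lambda>m. star (A m ` K) (A m ` L)) (star (\<phi> ` K) (\<phi> ` L))"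
    using cont[unfolded hausdorff_continuous_op_def, rule_format,
        of "\<lambda>m. A m ` K" "\<lambda>m. A m ` L" "\<phi> ` K" "\<phi> ` L"]
    by (simp add: tends KL imgs)
  then have "(\<lambda>m. support_fun (A m ` star K L) e) \<longlonglongrightarrow> support_fun (star (\<phi> ` K) (\<phi> ` L)) e"
    unfolding star_A by (rule tendsto_support_fun) (simp_all add: sym_zonoidsD(1,2) closed imgs KL)
  \<comment> \<open>The same sequence has a second limit: \<open>star K L\<close> is itself a
    symmetric zonoid, so the perturbation estimate applies to it directly.\<close>
  moreover have "(\<lambda>m. support_fun (A m ` star K L) e) \<longlonglongrightarrow> support_fun (\<phi> ` star K L) e"
    using tends[OF closed[OF KL]]
    by (rule tendsto_support_fun) (simp_all only: sym_zonoidsD(1,2) closed imgs KL, simp_all)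
  ultimately have "support_fun (\<phi> ` star K L) e = support_fun (star (\<phi> ` K) (\<phi> ` L)) e"
    using LIMSEQ_unique by blast
  \<comment> \<open>Since e \<bullet> e = 1, pairing the image of x with \<open>e\<close> returns u
    \<bullet> x.\<close>
  moreover have "support_fun (\<phi> ` star K L) e = support_fun (star K L) u"
    using e by (simp add: support_fun_def image_image \<phi>_def norm_eq_1)
  ultimately show ?thesis
    by (simp add: \<phi>_def[abs_def] rank_one_image_sym_zonoid KL)
qed

section \<open>The characterization\<close>

text \<open>For fixed \<open>t\<close> the difference D(s) = f(s, t) - f(0, t) satisfies D(2s) \<le>
  2 D(s), hence D(2^k s) \<le> 2^k D(s). On the other hand f(2^k s, t) is at least 2^k s a.
  Comparing the two, a positive gap in the claim would be multiplied by 2^k and yet stay below f(0,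
  t) for all k.\<close>

lemma additive_of_doubling:
  fixes f :: "real \<Rightarrow> real \<Rightarrow> real"
  assumes double: "\<And>s. 0 \<le> s \<Longrightarrow> f (2 * s) t + f 0 t \<le> 2 * f s t"
    and hom: "\<And>s. 0 \<le> s \<Longrightarrow> f s 0 = s * a"
    and lower: "\<And>s. 0 \<le> s \<Longrightarrow> f s 0 \<le> f s t"
    and s: "0 \<le> s"
  shows "s * a + f 0 t \<le> f s t"
proof -
  have "f (2 ^ k * s) t - f 0 t \<le> 2 ^ k * (f s t - f 0 t)" for k
  proof (induction k)
    case (Suc k)
    then show ?case using double[of "2 ^ k * s"] s by (simp add: algebra_simps)
  qed simp
  moreover have "2 ^ k * s * a \<le> f (2 ^ k * s) t" for k :: nat
    using lower[of "2 ^ k * s"] hom[of "2 ^ k * s"] s by simp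
  ultimately have bound: "2 ^ k * (s * a - f s t + f 0 t) \<le> f 0 t" for k :: nat
    by (smt (verit) mult.assoc right_diff_distrib' distrib_left)
  show ?thesis
  proof (rule ccontr)
    assume "\<not> ?thesis"
    then have pos: "0 < s * a - f s t + f 0 t" by simp
    obtain k where "f 0 t / (s * a - f s t + f 0 t) < 2 ^ k"
      using real_arch_pow[of 2] by auto
    then show False using bound[of k] pos by (simp add: pos_divide_less_eq)
  qed
qed

lemma support_fun_sym_segment: "support_fun (closed_segment (- a) a) u = \<bar>u \<bullet> a\<bar>"
  by (simp add: support_fun_closed_segment)

text \<open>The constants are f(1, 0) and f(0, 1). All values of \<open>f\<close> at nonnegative
  arguments are read off from the support function of a single zonoid \<open>S\<close>. Three
  orthonormal directions are used: two feed the first argument of \<open>f\<close>, the third feeds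
  the second.\<close>

lemma star_eq_Minkowski_combination:
  fixes star :: "(real^'n) set \<Rightarrow> (real^'n) set \<Rightarrow> (real^'n) set"
  assumes card: "CARD('n) \<ge> 3"
    and closed: "\<And>K L. K \<in> sym_zonoids \<Longrightarrow> L \<in> sym_zonoids \<Longrightarrow> star K L \<in> sym_zonoids"
    and cont: "hausdorff_continuous_op star" and cov: "GL_covariant_op star"
  obtains a b :: real where "a \<ge> 0" "b \<ge> 0"
    "\<And>K L. K \<in> sym_zonoids \<Longrightarrow> L \<in> sym_zonoids \<Longrightarrow>
      star K L = (\<lambda>x. a *\<^sub>R x) ` K + (\<lambda>x. b *\<^sub>R x) ` L"
proof -
  obtain I :: "'n set" where "card I = 3"
    using obtain_subset_with_card_n[OF card] by blast
  then obtain i j k :: 'n where ijk: "i \<noteq> j" "i \<noteq> k" "j \<noteq> k"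
    using card_3_iff by metis
  define e1 e2 e3 :: "real^'n" where e_def: "e1 = axis i 1" "e2 = axis j 1" "e3 = axis k 1"
  have inner_e: "e1 \<bullet> e1 = 1" "e2 \<bullet> e2 = 1" "e3 \<bullet> e3 = 1" "e1 \<bullet> e2 = 0" "e1 \<bullet> e3 = 0"
    "e2 \<bullet> e1 = 0" "e2 \<bullet> e3 = 0" "e3 \<bullet> e1 = 0" "e3 \<bullet> e2 = 0"
    using ijk by (auto simp: e_def inner_axis_axis)
  \<comment> \<open>The unit vector of the rank-one reduction is fixed as \<open>e1\<close>, so one
    function serves all bodies and all directions.\<close>
  define f where "f s t = support_fun (star (closed_segment (- (s *\<^sub>R e1)) (s *\<^sub>R e1))
      (closed_segment (- (t *\<^sub>R e1)) (t *\<^sub>R e1))) e1" for s t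
  have f: "support_fun (star K L) u = f (support_fun K u) (support_fun L u)"
    if "K \<in> sym_zonoids" "L \<in> sym_zonoids" for K L u
    unfolding f_def using support_fun_star[OF closed cont cov that] inner_e
    by (simp add: norm_eq_1)
  define S where "S = star (closed_segment (- e1) e1 + closed_segment (- e2) e2) (closed_segment (- e3) e3)"
  define H where "H = support_fun S"
  have S: "S \<in> sym_zonoids"
    unfolding S_def by (intro closed sym_zonoids_closed_segment_plus sym_zonoids_closed_segment)
  note S' = sym_zonoidsD(1,2)[OF S]
  have H: "H u = f (\<bar>u \<bullet> e1\<bar> + \<bar>u \<bullet> e2\<bar>) \<bar>u \<bullet> e3\<bar>" for u
    unfolding H_def S_def f[OF sym_zonoids_closed_segment_plus sym_zonoids_closed_segment]
    by (simp add: support_fun_set_plus support_fun_sym_segment)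
  note H_simps = H inner_add_left inner_diff_left inner_e
  have double: "f (2 * s) t + f 0 t \<le> 2 * f s t" if "0 \<le> s" "0 \<le> t" for s t
  proof -
    \<comment> \<open>With directions s e1, s e2 and t e3 the four-point inequality reads f(2s, t) +
      f(0, t) + 2 f(2s, 0) \<le> 2 f(s, t) + 4 f(s, 0); homogeneity cancels the terms with second
      argument 0.\<close>
    have "f (2 * s) 0 = 2 * f s 0"
      using support_fun_scaleR[OF S', of 2 "s *\<^sub>R e1"] that
      by (simp add: H_simps flip: H_def)
    then show ?thesis
      using zonoid_four_point_inequality[OF S, of "s *\<^sub>R e1" "s *\<^sub>R e2" "t *\<^sub>R e3"] that
      by (simp add: H_simps flip: H_def)
  qed
  have hom1: "f s 0 = s * f 1 0" if "0 \<le> s" for s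
    using support_fun_scaleR[OF S' that, of e1] that by (simp add: H_simps flip: H_def)
  have hom2: "f 0 t = t * f 0 1" if "0 \<le> t" for t
    using support_fun_scaleR[OF S' that, of e3] that by (simp add: H_simps flip: H_def)
  have upper: "f s t \<le> f s 0 + f 0 t" if "0 \<le> s" "0 \<le> t" for s t
    using support_fun_add_le[OF S', of "s *\<^sub>R e1" "t *\<^sub>R e3"] that
    by (simp add: H_simps flip: H_def)
  have lower: "f s 0 \<le> f s t" if "0 \<le> s" "0 \<le> t" for s t
  proof -
    \<comment> \<open>\<open>H\<close> depends on the third coordinate only through its absolute
      value, so both summands have the value f(s, t), while the sum has the value f(2s, 0).\<close>
    have "(s *\<^sub>R e1 + t *\<^sub>R e3) + (s *\<^sub>R e1 - t *\<^sub>R e3) = s *\<^sub>R e1 + s *\<^sub>R e1"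
      by (simp only: add_diff_eq) simp
    also have "\<dots> = (2 * s) *\<^sub>R e1"
      by (simp only: mult_2 scaleR_add_left)
    finally have "H ((2 * s) *\<^sub>R e1) \<le> H (s *\<^sub>R e1 + t *\<^sub>R e3) + H (s *\<^sub>R e1 - t *\<^sub>R e3)"
      using support_fun_add_le[OF S', of "s *\<^sub>R e1 + t *\<^sub>R e3" "s *\<^sub>R e1 - t *\<^sub>R e3"]
      by (simp only: H_def)
    then have "f (2 * s) 0 \<le> 2 * f s t"
      using that by (simp add: H_simps)
    then show ?thesis using hom1[of s] hom1[of "2 * s"] that by simp
  qed
  have f_eq: "f s t = s * f 1 0 + t * f 0 1" if "0 \<le> s" "0 \<le> t" for s t
  proof (rule antisym)
    show "f s t \<le> s * f 1 0 + t * f 0 1"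
      using upper[OF that] hom1[OF that(1)] hom2[OF that(2)] by simp
    have "s * f 1 0 + f 0 t \<le> f s t"
      by (rule additive_of_doubling) (use double hom1 lower that in blast)+
    then show "s * f 1 0 + t * f 0 1 \<le> f s t"
      using hom2[OF that(2)] by simp
  qed
  show thesis
  proof
    show a: "f 1 0 \<ge> 0"
      using support_fun_nonneg[OF S, of e1] by (simp add: H_simps flip: H_def)
    show b: "f 0 1 \<ge> 0"
      using support_fun_nonneg[OF S, of e3] by (simp add: H_simps flip: H_def)
    fix K L :: "(real^'n) set"
    assume KL: "K \<in> sym_zonoids" "L \<in> sym_zonoids"
    note K = sym_zonoidsD[OF KL(1)] and L = sym_zonoidsD[OF KL(2)]
    show "star K L = (\<lambda>x. f 1 0 *\<^sub>R x) ` K + (\<lambda>x. f 0 1 *\<^sub>R x) ` L"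
    \<comment> \<open>Both sides are compact and convex, so comparing support functions suffices;
      nonnegativity of the two constants lets them be pulled out.\<close>
    proof (rule support_fun_inject)
      show "support_fun (star K L) u = support_fun ((\<lambda>x. f 1 0 *\<^sub>R x) ` K + (\<lambda>x. f 0 1 *\<^sub>R x) ` L) u" for u
        using K L a b
        by (simp add: f[OF KL] f_eq[OF support_fun_nonneg support_fun_nonneg, OF KL] support_fun_set_plus compact_scaling
            support_fun_image_scaleR mult.commute)
    qed (use sym_zonoidsD[OF closed[OF KL]] K L in
        \<open>auto intro: compact_set_plus compact_scaling convex_set_plus convex_scaling
           simp: set_plus_nonempty\<close>)
  qed
qed

section \<open>The converse: Minkowski combinations are continuous and covariant\<close>

lemma Minkowski_combination_continuous:
  fixes star :: "('a::euclidean_space) set \<Rightarrow> 'a set \<Rightarrow> 'a set"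
  assumes star: "\<And>K L. K \<in> sym_zonoids \<Longrightarrow> L \<in> sym_zonoids \<Longrightarrow>
      star K L = (\<lambda>x. a *\<^sub>R x) ` K + (\<lambda>x. b *\<^sub>R x) ` L"
  shows "hausdorff_continuous_op star"
  unfolding hausdorff_continuous_op_def
proof (intro allI impI, elim conjE)
  fix K L :: "nat \<Rightarrow> 'a set" and M N
  assume KL: "\<forall>m. K m \<in> sym_zonoids" "\<forall>m. L m \<in> sym_zonoids" "M \<in> sym_zonoids" "N \<in> sym_zonoids"
    and lim: "hausdorff_tendsto K M" "hausdorff_tendsto L N"
  let ?s = "\<lambda>c X. (\<lambda>x::'a. c *\<^sub>R x) ` X"
  note cpt = sym_zonoidsD(1)[OF KL(1)[rule_format]] sym_zonoidsD(1)[OF KL(2)[rule_format]]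
      sym_zonoidsD(1)[OF KL(3)] sym_zonoidsD(1)[OF KL(4)]
    and ne = sym_zonoidsD(2)[OF KL(1)[rule_format]] sym_zonoidsD(2)[OF KL(2)[rule_format]]
      sym_zonoidsD(2)[OF KL(3)] sym_zonoidsD(2)[OF KL(4)]
  let ?o = "\<lambda>c. onorm (\<lambda>x::'a. c *\<^sub>R x)"
  have "hausdorff_tendsto (\<lambda>m. ?s a (K m) + ?s b (L m)) (?s a M + ?s b N)"
  proof (rule hausdorff_tendsto_squeeze)
    fix m
    show "compact (?s a (K m) + ?s b (L m)) \<and> ?s a (K m) + ?s b (L m) \<noteq> {}"
      using cpt ne by (simp add: compact_set_plus compact_scaling set_plus_nonempty)
    \<comment> \<open>Addition does not increase the sum of the two distances, and scaling is
      Lipschitz with its operator norm as constant.\<close>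
    have "hausdorff_dist (?s a (K m) + ?s b (L m)) (?s a M + ?s b N)
        \<le> hausdorff_dist (?s a (K m)) (?s a M) + hausdorff_dist (?s b (L m)) (?s b N)"
      using cpt ne by (intro hausdorff_dist_set_plus compact_scaling) auto
    also have "\<dots> \<le> ?o a * hausdorff_dist (K m) M + ?o b * hausdorff_dist (L m) N"
      using cpt ne by (intro add_mono hausdorff_dist_linear_image linear_scaleR) auto
    finally show "hausdorff_dist (?s a (K m) + ?s b (L m)) (?s a M + ?s b N)
        \<le> ?o a * hausdorff_dist (K m) M + ?o b * hausdorff_dist (L m) N" .
  next
    show "(\<lambda>m. ?o a * hausdorff_dist (K m) M + ?o b * hausdorff_dist (L m) N) \<longlonglongrightarrow> 0"
      using lim by (intro tendsto_add_zero hausdorff_tendsto_mult_zero)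
  qed
  then show "hausdorff_tendsto (\<lambda>m. star (K m) (L m)) (star M N)"
    using star KL by simp
qed

lemma Minkowski_combination_GL_covariant:
  fixes star :: "(real^'n) set \<Rightarrow> (real^'n) set \<Rightarrow> (real^'n) set"
  assumes star: "\<And>K L. K \<in> sym_zonoids \<Longrightarrow> L \<in> sym_zonoids \<Longrightarrow>
      star K L = (\<lambda>x. a *\<^sub>R x) ` K + (\<lambda>x. b *\<^sub>R x) ` L"
  shows "GL_covariant_op star"
  unfolding GL_covariant_op_def
proof (intro allI impI ballI)
  fix A :: "real^'n^'n" and K L :: "(real^'n) set"
  assume KL: "K \<in> sym_zonoids" "L \<in> sym_zonoids"
  then show "(*v) A ` star K L = star ((*v) A ` K) ((*v) A ` L)"
    by (simp add: star sym_zonoids_linear_image linear_image_set_plus image_image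
        matrix_vector_mult_scaleR)
qed

theorem theoremB:
  fixes star :: "(real^'n) set \<Rightarrow> (real^'n) set \<Rightarrow> (real^'n) set"
  assumes "CARD('n) \<ge> 3"
    and "\<And>K L. K \<in> sym_zonoids \<Longrightarrow> L \<in> sym_zonoids \<Longrightarrow> star K L \<in> sym_zonoids"
  shows "hausdorff_continuous_op star \<and> GL_covariant_op star \<longleftrightarrow>
     (\<exists>a b :: real. a \<ge> 0 \<and> b \<ge> 0 \<and>
        (\<forall>K\<in>sym_zonoids. \<forall>L\<in>sym_zonoids.
           star K L = (\<lambda>x. a *\<^sub>R x) ` K + (\<lambda>x. b *\<^sub>R x) ` L))"
proof
  assume "hausdorff_continuous_op star \<and> GL_covariant_op star"
  then have "hausdorff_continuous_op star" "GL_covariant_op star" by simp_all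
  from star_eq_Minkowski_combination[OF assms this]
  obtain a b :: real where "a \<ge> 0" "b \<ge> 0"
    "\<And>K L. K \<in> sym_zonoids \<Longrightarrow> L \<in> sym_zonoids \<Longrightarrow>
      star K L = (\<lambda>x. a *\<^sub>R x) ` K + (\<lambda>x. b *\<^sub>R x) ` L"
    by metis
  then show "\<exists>a b :: real. a \<ge> 0 \<and> b \<ge> 0 \<and>
        (\<forall>K\<in>sym_zonoids. \<forall>L\<in>sym_zonoids.
           star K L = (\<lambda>x. a *\<^sub>R x) ` K + (\<lambda>x. b *\<^sub>R x) ` L)"
    by (intro exI[of _ a] exI[of _ b]) simp
next
  assume "\<exists>a b :: real. a \<ge> 0 \<and> b \<ge> 0 \<and>
        (\<forall>K\<in>sym_zonoids. \<forall>L\<in>sym_zonoids.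
           star K L = (\<lambda>x. a *\<^sub>R x) ` K + (\<lambda>x. b *\<^sub>R x) ` L)"
  then obtain a b :: real where
    "\<And>K L. K \<in> sym_zonoids \<Longrightarrow> L \<in> sym_zonoids \<Longrightarrow>
      star K L = (\<lambda>x. a *\<^sub>R x) ` K + (\<lambda>x. b *\<^sub>R x) ` L"
    by auto
  then show "hausdorff_continuous_op star \<and> GL_covariant_op star"
    using Minkowski_combination_continuous[of star a b]
      Minkowski_combination_GL_covariant[of star a b] by simp
qed

end
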